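(* Suppose QM, CMR and the REACP hold (in the precise sense given in the context). Then the correlation $\langle a^{\bullet\circ}, b^{\circ\bullet}\rangle$, viewed as the function $F_4:\mathcal{Q}_+\to\mathbb{R}$ of $\boldsymbol{\theta}=(\theta_1,\theta_2,\theta_3)=(\theta_{ab},\theta_{a'b},\theta_{ab'})$, is differentiable at $\mathbf{0}=(0,0,0)$ with zero differential.
   Context: **Angles.** Angles lie in $\mathbf{T}=[-\pi,\pi]/(-\pi\sim\pi)$. For angles $\theta_c,\theta_d$ put $\theta_{cd}=\theta_c-\theta_d$. A quadruplet $\overline\theta=(\theta_a,\theta_{a'},\theta_b,\theta_{b'})\in\mathbf{T}^4$ consists of physical (actually used) angles $\theta_a$ (Alice), $\theta_b$ (Bob) and alternative angles $\theta_{a'}$ (Alice), $\theta_{b'}$ (Bob). Alice and Bob measure the normalized spin projections of the respective members of a sequence of spin-$\frac12$ pairs in the singlet state; corresponding measurements are space-like separated. **CMR (classical microscopic realism).** All observables that could be measured have well-defined values: for each realization (choice of physical angles) there are functions $(\alpha,\beta)\mapsto (A(\alpha,\beta),B(\alpha,\beta))$ with values in pairs of sequences indexed by $i\ge 1$ with entries in $\{-1,1\}$, where $A(\alpha,\beta)$ (resp. $B(\alpha,\beta)$) is the sequence Alice (resp. Bob) would obtain if Alice used the angle $\alpha$ and Bob the angle $\beta$. These functions may differ from one realization to another. For a quadruplet $\overline\theta$, in the realization with physical angles $\theta_a,\theta_b$, set $a^{\circ\circ}=A(\theta_a,\theta_b)$, $b^{\circ\circ}=B(\theta_a,\theta_b)$;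 $a^{\bullet\circ}=A(\theta_{a'},\theta_b)$, $b^{\bullet\circ}=B(\theta_{a'},\theta_b)$; $a^{\circ\bullet}=A(\theta_a,\theta_{b'})$, $b^{\circ\bullet}=B(\theta_a,\theta_{b'})$; $a^{\bullet\bullet}=A(\theta_{a'},\theta_{b'})$, $b^{\bullet\bullet}=B(\theta_{a'},\theta_{b'})$. **Correlations.** $\langle u,v\rangle=\lim_{n\to\infty}\frac1n\sum_{i=1}^n u_iv_i$; the limits defining the correlations $\langle a^{s_1t_1},b^{s_2t_2}\rangle$ used are assumed to exist. **QM.** Jointly measured or jointly measurable pairs obey the twisted Malus law: $\langle a^{\circ\circ},b^{\circ\circ}\rangle=-\cos\theta_{ab}$, $\langle a^{\circ\bullet},b^{\circ\bullet}\rangle=-\cos\theta_{ab'}$, $\langle a^{\bullet\circ},b^{\bullet\circ}\rangle=-\cos\theta_{a'b}$, $\langle a^{\bullet\bullet},b^{\bullet\bullet}\rangle=-\cos\theta_{a'b'}$. **REACP (restricted effect-after-cause principle).** For any Lorentz observer, the registered value of an observable for a physical choice of angle cannot change because of further choices that are made after registration. Concretely, each Lorentz observer $O$ has such functions $A^O,B^O$ ($A,B$ being those of some fixed observer). If for $O$ Bob's measurements precede Alice's corresponding ones, then $B^O(\alpha,\theta_b)$, with $\theta_b$ the physical angle, does not depend on Alice's choice $\alpha$; if for $O$ Alice's measurements precede Bob's, then $A^O(\theta_a,\beta)$, with $\theta_a$ the physical angle, does not depend on Bob's choice $\beta$. By space-like separation observers of both kinds exist. Moreover $a^{\circ\circ},a^{\circ\bullet},b^{\circ\circ},b^{\bullet\circ}$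 are required not to depend on the Lorentz observer (nothing is required of the other sequences). **The function $F_4$.** $\mathcal{Q}_+=\{(\theta_1,\theta_2,\theta_3)\in\mathbb{R}^3: 0\le\theta_i\le\pi,\ i=1,2,3\}$. The correlation $\langle a^{\bullet\circ},b^{\circ\bullet}\rangle$ is regarded as a function of the three differences $\theta_1=\theta_{ab}$, $\theta_2=\theta_{a'b}$, $\theta_3=\theta_{ab'}$ only, and $F_4:\mathcal{Q}_+\to\mathbb{R}$ is $F_4(\boldsymbol\theta)=\langle a^{\bullet\circ},b^{\circ\bullet}\rangle$. Differentiability at points of $\mathcal{Q}_+$ is relative to $\mathcal{Q}_+$. *)

theory Defs
  imports "HOL-Analysis.Analysis"
begin

text \<open>
  Angles form the circle obtained from the interval from \<open>-pi\<close> to \<open>pi\<close> by gluing its end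
  points. It is realised as the reals modulo \<open>2 * pi\<close>, so that differences of angles make sense;
  the lemmas \<open>angle_of_image\<close> and \<open>angle_of_eq_on_interval\<close> identify the two descriptions.
\<close>

definition angle_eq :: "real \<Rightarrow> real \<Rightarrow> bool" where
  "angle_eq x y \<longleftrightarrow> (\<exists>k::int. x - y = 2 * pi * of_int k)"

lemma equivp_angle_eq: "equivp angle_eq"
proof (rule equivpI)
  show "reflp angle_eq"
    by (rule reflpI) (simp add: angle_eq_def)
  show "symp angle_eq"
  proof (rule sympI)
    fix x y assume "angle_eq x y"
    then obtain k :: int where "x - y = 2 * pi * of_int k"
      by (auto simp: angle_eq_def)
    then have "y - x = 2 * pi * of_int (- k)" by simp
    then show "angle_eq y x" unfolding angle_eq_def by blast
  qed
  show "transp angle_eq"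
  proof (rule transpI)
    fix x y z assume "angle_eq x y" "angle_eq y z"
    then obtain k l :: int where "x - y = 2 * pi * of_int k" "y - z = 2 * pi * of_int l"
      by (auto simp: angle_eq_def)
    then have "x - z = 2 * pi * of_int (k + l)" by (simp add: algebra_simps)
    then show "angle_eq x z" unfolding angle_eq_def by blast
  qed
qed

quotient_type angle = real / angle_eq
  morphisms rep_angle angle_of
  by (rule equivp_angle_eq)

instantiation angle :: ab_group_add
begin

lift_definition zero_angle :: angle is 0 .

lift_definition plus_angle :: "angle \<Rightarrow> angle \<Rightarrow> angle" is "(+)"
proof -
  fix x y z w assume "angle_eq x y" "angle_eq z w"
  then obtain k l :: int where "x - y = 2 * pi * of_int k" "z - w = 2 * pi * of_int l"
    by (auto simp: angle_eq_def)
  then have "(x + z) - (y + w) = 2 * pi * of_int (k + l)" by (simp add: algebra_simps)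
  then show "angle_eq (x + z) (y + w)" unfolding angle_eq_def by blast
qed

lift_definition minus_angle :: "angle \<Rightarrow> angle \<Rightarrow> angle" is "(-)"
proof -
  fix x y z w assume "angle_eq x y" "angle_eq z w"
  then obtain k l :: int where "x - y = 2 * pi * of_int k" "z - w = 2 * pi * of_int l"
    by (auto simp: angle_eq_def)
  then have "(x - z) - (y - w) = 2 * pi * of_int (k - l)" by (simp add: algebra_simps)
  then show "angle_eq (x - z) (y - w)" unfolding angle_eq_def by blast
qed

lift_definition uminus_angle :: "angle \<Rightarrow> angle" is uminus
proof -
  fix x y assume "angle_eq x y"
  then obtain k :: int where "x - y = 2 * pi * of_int k"
    by (auto simp: angle_eq_def)
  then have "- x - - y = 2 * pi * of_int (- k)" by simp
  then show "angle_eq (- x) (- y)" unfolding angle_eq_def by blast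
qed

instance
  by standard (transfer; simp add: angle_eq_def algebra_simps exI[of _ "0::int"])+

end

lift_definition cos_angle :: "angle \<Rightarrow> real" is cos
proof -
  fix x y assume "angle_eq x y"
  then obtain k :: int where "x - y = 2 * pi * of_int k"
    by (auto simp: angle_eq_def)
  then have "x = y + of_int k * (2 * pi)" by (simp add: algebra_simps)
  then show "cos x = cos y" using cos.plus_of_int[of y k] by simp
qed

lemma angle_of_eq_iff: "angle_of x = angle_of y \<longleftrightarrow> (\<exists>k::int. x - y = 2 * pi * of_int k)"
  by (simp add: angle.abs_eq_iff angle_eq_def)

lemma angle_of_image: "angle_of ` {-pi..pi} = UNIV"
proof -
  have "t \<in> angle_of ` {-pi..pi}" for t
  proof -
    obtain x where t: "t = angle_of x" by (metis Quotient_abs_rep[OF Quotient_angle])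
    define k where "k = \<lfloor>(x + pi) / (2 * pi)\<rfloor>"
    define y where "y = x - 2 * pi * of_int k"
    have "of_int k \<le> (x + pi) / (2 * pi)" "(x + pi) / (2 * pi) < of_int k + 1"
      unfolding k_def by linarith+
    then have "y \<in> {-pi..pi}"
      unfolding y_def by (auto simp: field_simps)
    moreover have "t = angle_of y"
      unfolding t angle_of_eq_iff y_def by auto
    ultimately show ?thesis by blast
  qed
  then show ?thesis by blast
qed

lemma angle_of_eq_on_interval:
  assumes "x \<in> {-pi..pi}" "y \<in> {-pi..pi}"
  shows "angle_of x = angle_of y \<longleftrightarrow> x = y \<or> (x = -pi \<and> y = pi) \<or> (x = pi \<and> y = -pi)"
proof
  assume "angle_of x = angle_of y"
  then obtain k :: int where k: "x - y = 2 * pi * of_int k"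
    by (auto simp: angle_of_eq_iff)
  have "\<bar>2 * pi * of_int k\<bar> \<le> 2 * pi * 1"
    using assms unfolding k[symmetric] by auto
  then have "\<bar>of_int k :: real\<bar> \<le> 1"
    by (simp add: abs_mult)
  then have "k = -1 \<or> k = 0 \<or> k = 1" by linarith
  then show "x = y \<or> (x = -pi \<and> y = pi) \<or> (x = pi \<and> y = -pi)"
    using k assms by auto
next
  assume "x = y \<or> (x = -pi \<and> y = pi) \<or> (x = pi \<and> y = -pi)"
  then show "angle_of x = angle_of y"
    unfolding angle_of_eq_iff
    by (elim disjE) (auto intro: exI[of _ "0::int"] exI[of _ "1::int"] exI[of _ "-1::int"])
qed

text \<open>Sequences of outcomes are indexed by \<open>i \<ge> 1\<close>; the value at \<open>0\<close> is never used.\<close>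

type_synonym outcomes = "nat \<Rightarrow> real"

definition has_correlation :: "outcomes \<Rightarrow> outcomes \<Rightarrow> real \<Rightarrow> bool" where
  "has_correlation u v c \<longleftrightarrow> (\<lambda>n. (\<Sum>i=1..n. u i * v i) / real n) \<longlonglongrightarrow> c"

definition same_outcomes :: "outcomes \<Rightarrow> outcomes \<Rightarrow> bool" where
  "same_outcomes u v \<longleftrightarrow> (\<forall>i\<ge>1. u i = v i)"

text \<open>
  A realization is a choice of the two physical angles (Alice's first). For a realization \<open>r\<close>,
  \<open>R r \<alpha> \<beta>\<close> is the sequence one of the parties would obtain if Alice used \<open>\<alpha>\<close> and Bob
  used \<open>\<beta>\<close>.
\<close>

type_synonym realization = "angle \<times> angle"
type_synonym response = "realization \<Rightarrow> angle \<Rightarrow> angle \<Rightarrow> outcomes"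

record quadruplet =
  ang_a :: angle
  ang_a' :: angle
  ang_b :: angle
  ang_b' :: angle

text \<open>\<open>Phys\<close> and \<open>Alt\<close> stand for the superscripts \<open>\<circ>\<close> and \<open>\<bullet>\<close>.\<close>

datatype choice = Phys | Alt

fun alice_angle :: "quadruplet \<Rightarrow> choice \<Rightarrow> angle" where
  "alice_angle q Phys = ang_a q"
| "alice_angle q Alt = ang_a' q"

fun bob_angle :: "quadruplet \<Rightarrow> choice \<Rightarrow> angle" where
  "bob_angle q Phys = ang_b q"
| "bob_angle q Alt = ang_b' q"

text \<open>
  For Alice's response \<open>A\<close> and Bob's response \<open>B\<close>, the sequences \<open>a\<^sup>s\<^sup>t\<close> and \<open>b\<^sup>s\<^sup>t\<close> are
  \<open>seq A q s t\<close> and \<open>seq B q s t\<close>.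
\<close>

definition seq :: "response \<Rightarrow> quadruplet \<Rightarrow> choice \<Rightarrow> choice \<Rightarrow> outcomes" where
  "seq R q s t = R (ang_a q, ang_b q) (alice_angle q s) (bob_angle q t)"

text \<open>
  The type \<open>'o\<close> is that of the Lorentz observers; \<open>A obs\<close> and \<open>B obs\<close> are the
  response functions for the observer \<open>obs\<close>.
\<close>

definition CMR :: "('o \<Rightarrow> response) \<Rightarrow> ('o \<Rightarrow> response) \<Rightarrow> bool" where
  "CMR A B \<longleftrightarrow>
     (\<forall>obs r \<alpha> \<beta>. \<forall>i\<ge>1. A obs r \<alpha> \<beta> i \<in> {-1, 1} \<and> B obs r \<alpha> \<beta> i \<in> {-1, 1})"

definition QM :: "response \<Rightarrow> response \<Rightarrow> bool" where
  "QM A B \<longleftrightarrow>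
     (\<forall>q s t. has_correlation (seq A q s t) (seq B q s t)
                (- cos_angle (alice_angle q s - bob_angle q t)))"

text \<open>
  \<open>tA obs r i\<close> and \<open>tB obs r i\<close> are the times that the observer \<open>obs\<close> assigns, in the
  realization \<open>r\<close>, to the \<open>i\<close>-th measurement of Alice and of Bob.
\<close>

type_synonym 'o timing = "'o \<Rightarrow> realization \<Rightarrow> nat \<Rightarrow> real"

definition precede :: "(nat \<Rightarrow> real) \<Rightarrow> (nat \<Rightarrow> real) \<Rightarrow> bool" where
  "precede t t' \<longleftrightarrow> (\<forall>i\<ge>1. t i < t' i)"

text \<open>The consequence of space-like separation that is used: both time orders are observed.\<close>

definition both_orders_observed :: "'o timing \<Rightarrow> 'o timing \<Rightarrow> bool" where
  "both_orders_observed tA tB \<longleftrightarrow>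
     (\<forall>r. (\<exists>obs. precede (tA obs r) (tB obs r)) \<and> (\<exists>obs. precede (tB obs r) (tA obs r)))"

definition REACP ::
  "'o timing \<Rightarrow> 'o timing \<Rightarrow> ('o \<Rightarrow> response) \<Rightarrow> ('o \<Rightarrow> response) \<Rightarrow> bool" where
  "REACP tA tB A B \<longleftrightarrow>
     (\<forall>obs \<theta>a \<theta>b. precede (tB obs (\<theta>a, \<theta>b)) (tA obs (\<theta>a, \<theta>b)) \<longrightarrow>
        (\<forall>\<alpha> \<alpha>'. same_outcomes (B obs (\<theta>a, \<theta>b) \<alpha> \<theta>b) (B obs (\<theta>a, \<theta>b) \<alpha>' \<theta>b))) \<and>
     (\<forall>obs \<theta>a \<theta>b. precede (tA obs (\<theta>a, \<theta>b)) (tB obs (\<theta>a, \<theta>b)) \<longrightarrow>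
        (\<forall>\<beta> \<beta>'. same_outcomes (A obs (\<theta>a, \<theta>b) \<theta>a \<beta>) (A obs (\<theta>a, \<theta>b) \<theta>a \<beta>'))) \<and>
     (\<forall>obs obs' q.
        same_outcomes (seq (A obs) q Phys Phys) (seq (A obs') q Phys Phys) \<and>
        same_outcomes (seq (A obs) q Phys Alt) (seq (A obs') q Phys Alt) \<and>
        same_outcomes (seq (B obs) q Phys Phys) (seq (B obs') q Phys Phys) \<and>
        same_outcomes (seq (B obs) q Alt Phys) (seq (B obs') q Alt Phys))"

definition Q_plus :: "(real ^ 3) set" where
  "Q_plus = {\<theta>. \<forall>i. 0 \<le> \<theta> $ i \<and> \<theta> $ i \<le> pi}"

text \<open>
  \<open>is_F4 A B F\<close> contains the two standing assumptions that the limit defining the correlation of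
  \<open>seq A q Alt Phys\<close> and \<open>seq B q Phys Alt\<close> exists and that it depends only on the three angle
  differences. It determines \<open>F\<close> on \<open>Q_plus\<close>, since every point there is the triple of differences
  of some quadruplet; the values of \<open>F\<close> elsewhere are arbitrary.
\<close>

definition is_F4 :: "response \<Rightarrow> response \<Rightarrow> (real ^ 3 \<Rightarrow> real) \<Rightarrow> bool" where
  "is_F4 A B F \<longleftrightarrow>
     (\<forall>\<theta>\<in>Q_plus. \<forall>q.
        ang_a q - ang_b q = angle_of (\<theta> $ 1) \<and>
        ang_a' q - ang_b q = angle_of (\<theta> $ 2) \<and>
        ang_a q - ang_b' q = angle_of (\<theta> $ 3) \<longrightarrow>
        has_correlation (seq A q Alt Phys) (seq B q Phys Alt) (F \<theta>))"

end

theory Submission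
  imports Defs
begin

text \<open>
  The principle identifies \<open>a\<^sup>\<circ>\<^sup>\<circ>\<close> with \<open>a\<^sup>\<circ>\<^sup>\<bullet>\<close> and \<open>b\<^sup>\<circ>\<^sup>\<circ>\<close> with \<open>b\<^sup>\<bullet>\<^sup>\<circ>\<close>, so the sequences
  \<open>a\<^sup>\<bullet>\<^sup>\<circ>\<close>, \<open>b\<^sup>\<circ>\<^sup>\<circ>\<close>, \<open>a\<^sup>\<circ>\<^sup>\<circ>\<close>, \<open>b\<^sup>\<circ>\<^sup>\<bullet>\<close> form a chain whose consecutive members have correlations
  \<open>-cos \<theta>\<^sub>2\<close>, \<open>-cos \<theta>\<^sub>1\<close>, \<open>-cos \<theta>\<^sub>3\<close>. Wherever consecutive members are always opposite, so are the
  two ends. Hence the density of indices at which the ends agree is at most the sum of the three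
  densities of agreement along the chain, that is
  \<open>0 \<le> 1 + F\<^sub>4 \<theta> \<le> (1 - cos \<theta>\<^sub>1) + (1 - cos \<theta>\<^sub>2) + (1 - cos \<theta>\<^sub>3)\<close>, which is quadratically small.
\<close>

lemma same_outcomes_trans: "same_outcomes u v \<Longrightarrow> same_outcomes v w \<Longrightarrow> same_outcomes u w"
  by (simp add: same_outcomes_def)

lemma has_correlation_cong:
  assumes "same_outcomes u u'" "same_outcomes v v'"
  shows "has_correlation u v c \<longleftrightarrow> has_correlation u' v' c"
proof -
  have "(\<Sum>i=1..n. u i * v i) = (\<Sum>i=1..n. u' i * v' i)" for n
    using assms by (intro sum.cong) (auto simp: same_outcomes_def)
  then show ?thesis by (simp add: has_correlation_def)
qed

text \<open>The upper bound is one of the CHSH inequalities. It holds index by index, hence for the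
  averages and in the limit.\<close>

lemma correlation_chain_bound:
  assumes signs: "\<And>i. i \<ge> 1 \<Longrightarrow> a i \<in> {-1, 1} \<and> b i \<in> {-1, 1} \<and> a' i \<in> {-1, 1} \<and> b' i \<in> {-1, 1}"
    and ab: "has_correlation a b c1"
    and a'b: "has_correlation a' b c2"
    and ab': "has_correlation a b' c3"
    and a'b': "has_correlation a' b' c4"
  shows "-1 \<le> c4" "c4 \<le> 2 + c1 + c2 + c3"
proof -
  show "-1 \<le> c4"
  proof (rule LIMSEQ_le_const[OF a'b'[unfolded has_correlation_def]], intro exI allI impI)
    fix n :: nat assume n: "1 \<le> n"
    have "(\<Sum>i=1..n. -1) \<le> (\<Sum>i=1..n. a' i * b' i)"
      by (rule sum_mono) (use signs in force)
    then show "-1 \<le> (\<Sum>i=1..n. a' i * b' i) / real n"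
      using n by (simp add: field_simps)
  qed
  have rhs: "(\<lambda>n. 2 + (\<Sum>i=1..n. a i * b i) / real n + (\<Sum>i=1..n. a' i * b i) / real n
               + (\<Sum>i=1..n. a i * b' i) / real n) \<longlonglongrightarrow> 2 + c1 + c2 + c3"
    using ab a'b ab' unfolding has_correlation_def by (intro tendsto_intros)
  show "c4 \<le> 2 + c1 + c2 + c3"
  proof (rule LIMSEQ_le[OF a'b'[unfolded has_correlation_def] rhs], intro exI allI impI)
    fix n :: nat assume n: "1 \<le> n"
    \<comment> \<open>For signs, \<open>a' i * b' i\<close> is the product \<open>x * y * z\<close>
      of \<open>x = a i * b i\<close>, \<open>y = a' i * b i\<close>, \<open>z = a i * b' i\<close>,
      and \<open>x * y * z \<le> 2 + x + y + z\<close>, with equality when at most one of them is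
      \<open>1\<close>.\<close>
    have "(\<Sum>i=1..n. a' i * b' i) \<le> (\<Sum>i=1..n. 2 + a i * b i + a' i * b i + a i * b' i)"
    proof (rule sum_mono)
      fix i assume "i \<in> {1..n}"
      then show "a' i * b' i \<le> 2 + a i * b i + a' i * b i + a i * b' i"
        using signs[of i] by auto
    qed
    also have "\<dots> = real n * 2 + (\<Sum>i=1..n. a i * b i) + (\<Sum>i=1..n. a' i * b i)
                     + (\<Sum>i=1..n. a i * b' i)"
      by (simp add: sum.distrib)
    finally show "(\<Sum>i=1..n. a' i * b' i) / real n
        \<le> 2 + (\<Sum>i=1..n. a i * b i) / real n + (\<Sum>i=1..n. a' i * b i) / real n
            + (\<Sum>i=1..n. a i * b' i) / real n"
      using n by (simp add: field_simps)
  qed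
qed

text \<open>An observer who sees Alice measure first has the two sequences equal; since both are
  observer-independent, the equality passes to every \<open>obs\<close>.\<close>

lemma REACP_alice:
  assumes "both_orders_observed tA tB" "REACP tA tB A B"
  shows "same_outcomes (seq (A obs) q Phys Alt) (seq (A obs) q Phys Phys)"
proof -
  obtain obs' where "precede (tA obs' (ang_a q, ang_b q)) (tB obs' (ang_a q, ang_b q))"
    using assms(1) unfolding both_orders_observed_def by blast
  then have "same_outcomes (seq (A obs') q Phys Alt) (seq (A obs') q Phys Phys)"
    using assms(2) by (simp add: REACP_def seq_def)
  moreover have "same_outcomes (seq (A obs) q Phys Alt) (seq (A obs') q Phys Alt)"
    and "same_outcomes (seq (A obs') q Phys Phys) (seq (A obs) q Phys Phys)"
    using assms(2) unfolding REACP_def by blast+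
  ultimately show ?thesis by (blast intro: same_outcomes_trans)
qed

lemma REACP_bob:
  assumes "both_orders_observed tA tB" "REACP tA tB A B"
  shows "same_outcomes (seq (B obs) q Alt Phys) (seq (B obs) q Phys Phys)"
proof -
  obtain obs' where "precede (tB obs' (ang_a q, ang_b q)) (tA obs' (ang_a q, ang_b q))"
    using assms(1) unfolding both_orders_observed_def by blast
  then have "same_outcomes (seq (B obs') q Alt Phys) (seq (B obs') q Phys Phys)"
    using assms(2) by (simp add: REACP_def seq_def)
  moreover have "same_outcomes (seq (B obs) q Alt Phys) (seq (B obs') q Alt Phys)"
    and "same_outcomes (seq (B obs') q Phys Phys) (seq (B obs) q Phys Phys)"
    using assms(2) unfolding REACP_def by blast+
  ultimately show ?thesis by (blast intro: same_outcomes_trans)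
qed

lemma F4_bounds:
  assumes cmr: "CMR A B"
    and qm: "QM (A obs) (B obs)"
    and orders: "both_orders_observed tA tB"
    and reacp: "REACP tA tB A B"
    and F: "is_F4 (A obs) (B obs) F"
    and \<theta>: "\<theta> \<in> Q_plus"
  shows "-1 \<le> F \<theta>" "F \<theta> \<le> 2 - cos (\<theta> $ 1) - cos (\<theta> $ 2) - cos (\<theta> $ 3)"
proof -
  \<comment> \<open>With \<open>ang_b = 0\<close> the first two differences are the angles
    themselves, and \<open>ang_b'\<close> is solved from the third.\<close>
  define q where "q = \<lparr>ang_a = angle_of (\<theta> $ 1), ang_a' = angle_of (\<theta> $ 2),
    ang_b = 0, ang_b' = angle_of (\<theta> $ 1) - angle_of (\<theta> $ 3)\<rparr>"
  have angles: "ang_a q - ang_b q = angle_of (\<theta> $ 1)" "ang_a' q - ang_b q = angle_of (\<theta> $ 2)"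
    "ang_a q - ang_b' q = angle_of (\<theta> $ 3)"
    by (simp_all add: q_def)
  let ?a = "seq (A obs) q Phys Phys" and ?b = "seq (B obs) q Phys Phys"
  let ?a' = "seq (A obs) q Alt Phys" and ?b' = "seq (B obs) q Phys Alt"
  have malus: "has_correlation (seq (A obs) q s t) (seq (B obs) q s t)
      (- cos_angle (alice_angle q s - bob_angle q t))" for s t
    using qm unfolding QM_def by blast
  have refl: "same_outcomes u u" for u
    by (simp add: same_outcomes_def)
  have ab: "has_correlation ?a ?b (- cos (\<theta> $ 1))"
    using malus[of Phys Phys] by (simp add: angles cos_angle.abs_eq)
  \<comment> \<open>Malus's law pairs \<open>?a'\<close> with \<open>seq (B obs) q Alt Phys\<close>,
    which the principle lets one replace by \<open>?b\<close>. The next step does the same on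
    Alice's side.\<close>
  have a'b: "has_correlation ?a' ?b (- cos (\<theta> $ 2))"
    using malus[of Alt Phys] has_correlation_cong[OF refl REACP_bob[OF orders reacp]]
    by (simp add: angles cos_angle.abs_eq)
  have ab': "has_correlation ?a ?b' (- cos (\<theta> $ 3))"
    using malus[of Phys Alt] has_correlation_cong[OF REACP_alice[OF orders reacp] refl]
    by (simp add: angles cos_angle.abs_eq)
  have a'b': "has_correlation ?a' ?b' (F \<theta>)"
    using F \<theta> angles unfolding is_F4_def by blast
  have signs: "?a i \<in> {-1, 1} \<and> ?b i \<in> {-1, 1} \<and> ?a' i \<in> {-1, 1} \<and> ?b' i \<in> {-1, 1}"
    if "i \<ge> 1" for i
    using cmr that unfolding CMR_def seq_def by blast
  note bounds = correlation_chain_bound[OF signs ab a'b ab' a'b']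
  show "-1 \<le> F \<theta>" by (rule bounds(1))
  show "F \<theta> \<le> 2 - cos (\<theta> $ 1) - cos (\<theta> $ 2) - cos (\<theta> $ 3)" using bounds(2) by simp
qed

lemma one_minus_cos_le: "1 - cos x \<le> x\<^sup>2 / 2" for x :: real
proof -
  have "1 - cos x = 2 * (sin (x / 2))\<^sup>2"
    using cos_double_sin[of "x / 2"] by simp
  also have "(sin (x / 2))\<^sup>2 \<le> (x / 2)\<^sup>2"
    using abs_sin_x_le_abs_x[of "x / 2"] by (simp only: abs_le_square_iff)
  finally show ?thesis by (simp add: power_divide)
qed

lemma has_derivative_zero_if_quadratic_bound:
  fixes f :: "'a::real_normed_vector \<Rightarrow> real"
  assumes bound: "\<And>y. y \<in> S \<Longrightarrow> \<bar>f y - f x\<bar> \<le> C * (norm (y - x))\<^sup>2"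
  shows "(f has_derivative (\<lambda>_. 0)) (at x within S)"
  unfolding has_derivative_iff_norm
proof
  have lim: "((\<lambda>y. C * norm (y - x)) \<longlongrightarrow> 0) (at x within S)"
    by (auto intro!: tendsto_eq_intros)
  show "((\<lambda>y. norm (f y - f x - 0) / norm (y - x)) \<longlongrightarrow> 0) (at x within S)"
  proof (rule tendsto_sandwich[OF _ _ tendsto_const lim])
    show "\<forall>\<^sub>F y in at x within S. 0 \<le> norm (f y - f x - 0) / norm (y - x)"
      by simp
    show "\<forall>\<^sub>F y in at x within S. norm (f y - f x - 0) / norm (y - x) \<le> C * norm (y - x)"
      \<comment> \<open>This exposes the premise \<open>y \<in> S\<close>, under which the estimate
        holds everywhere and not only near \<open>x\<close>.\<close>
      unfolding eventually_at_filter
      by (rule always_eventually)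
        (use bound in \<open>auto simp: divide_le_eq power2_eq_square mult.assoc\<close>)
  qed
qed (rule bounded_linear_zero)

theorem theorem1:
  fixes A B :: "'o \<Rightarrow> response"
    and tA tB :: "'o timing"
    and obs0 :: 'o
    and F4 :: "real ^ 3 \<Rightarrow> real"
  assumes "CMR A B"
    and "QM (A obs0) (B obs0)"
    and "both_orders_observed tA tB"
    and "REACP tA tB A B"
    and "is_F4 (A obs0) (B obs0) F4"
  shows "(F4 has_derivative (\<lambda>_. 0)) (at 0 within Q_plus)"
proof (rule has_derivative_zero_if_quadratic_bound)
  note bounds = F4_bounds[OF assms]
  have "(0 :: real ^ 3) \<in> Q_plus"
    by (simp add: Q_plus_def)
  \<comment> \<open>At the origin the upper bound is \<open>2 - 3\<close>, so it meets the lower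
    bound.\<close>
  from bounds[OF this] have F4_0: "F4 0 = -1"
    by simp
  fix \<theta> :: "real ^ 3" assume \<theta>: "\<theta> \<in> Q_plus"
  have "F4 \<theta> + 1 \<le> ((\<theta> $ 1)\<^sup>2 + (\<theta> $ 2)\<^sup>2 + (\<theta> $ 3)\<^sup>2) / 2"
    using bounds(2)[OF \<theta>] one_minus_cos_le[of "\<theta> $ 1"] one_minus_cos_le[of "\<theta> $ 2"]
      one_minus_cos_le[of "\<theta> $ 3"] by (simp add: add_divide_distrib)
  also have "(\<theta> $ 1)\<^sup>2 + (\<theta> $ 2)\<^sup>2 + (\<theta> $ 3)\<^sup>2 = (norm \<theta>)\<^sup>2"
    unfolding power2_norm_eq_inner by (simp add: inner_vec_def sum_3 power2_eq_square)
  finally show "\<bar>F4 \<theta> - F4 0\<bar> \<le> 1 / 2 * (norm (\<theta> - 0))\<^sup>2"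
    using bounds(1)[OF \<theta>] F4_0 by simp
qed

end
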